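(* Let $G=(Q,\Sigma,\delta,I)$ be a discrete-event system with secret states $Q_S\subseteq Q$, non-secret states $Q_{NS}\subseteq Q$, and projection $P\colon\Sigma^*\to\Sigma_o^*$. Let $G^+$ and $G^-$ be two disjoint copies of $G$ with state sets $Q^+=\{q^+\mid q\in Q\}$ and $Q^-=\{q^-\mid q\in Q\}$, and let $@\notin\Sigma$ be a new observable event. Let $G''=(Q\cup Q^+\cup Q^-,\Sigma\cup\{@\},\delta'',I)$, where $\delta''$ consists of all transitions of $G$, $G^+$, and $G^-$ together with the transitions $(q,@,q^+)$ for every $q\in Q_S$ and $(q,@,q^-)$ for every $q\in Q_{NS}$. Let $Q_S''=Q^+$, $Q_{NS}''=Q\cup Q^-$, and let $P''\colon(\Sigma\cup\{@\})^*\to(\Sigma_o\cup\{@\})^*$ be the projection. Then $G$ is infinite-step opaque with respect to $Q_S$, $Q_{NS}$, and $P$ if and only if $G''$ is current-state opaque with respect to $Q_S''$, $Q_{NS}''$, and $P''$.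
   Context: An NFA over a finite nonempty alphabet $\Sigma$ is $(Q,\Sigma,\delta,I)$ with finite state set $Q$, initial states $I\subseteq Q$, and $\delta\colon Q\times\Sigma\to 2^Q$, extended in the usual way to $2^Q\times\Sigma^*$; a transition $(p,a,q)$ means $q\in\delta(p,a)$. $L(G)=\{w\mid\delta(I,w)\ne\emptyset\}$. A discrete-event system (DES) is an NFA together with a partition of $\Sigma$ into observable events $\Sigma_o$ and unobservable events $\Sigma_{uo}$. A projection is the morphism on strings erasing the unobservable events and keeping the observable ones. $K$-step opacity, for $K\in\mathbb{N}\cup\{\infty\}$: $G$ is $K$-step opaque w.r.t. secret states $Q_S$, non-secret states $Q_{NS}$, and $P$ if for every $st\in L(G)$ with $|P(t)|\le K$ and $\delta(\delta(I,s)\cap Q_S,t)\neq\emptyset$, there is $s't'\in L(G)$ such that $P(s)=P(s')$, $P(t)=P(t')$, and $\delta(\delta(I,s')\cap Q_{NS},t')\neq\emptyset$. Current-state opacity is $0$-step opacity; infinite-step opacity is $\infty$-step opacity (no bound on $|P(t)|$). States that are in neither $Q_S$ nor $Q_{NS}$ are allowed. *)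

theory Defs
  imports Main "HOL-Library.Extended_Nat"
begin

record ('q, 'a) nfa =
  states :: "'q set"
  alphabet :: "'a set"
  delta :: "'q \<Rightarrow> 'a \<Rightarrow> 'q set"
  initial :: "'q set"

definition is_nfa :: "('q, 'a, 'm) nfa_scheme \<Rightarrow> bool" where
  "is_nfa G \<longleftrightarrow>
     finite (states G) \<and> finite (alphabet G) \<and> alphabet G \<noteq> {} \<and>
     initial G \<subseteq> states G \<and>
     (\<forall>q \<in> states G. \<forall>a \<in> alphabet G. delta G q a \<subseteq> states G)"

text \<open>The function \<open>delta\<close> is only meaningful on \<open>states G\<close> and \<open>alphabet G\<close>; its values
  elsewhere are arbitrary and never contribute to \<open>transitions\<close> or \<open>language\<close>.\<close>

definition transitions :: "('q, 'a, 'm) nfa_scheme \<Rightarrow> ('q \<times> 'a \<times> 'q) set" where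
  "transitions G = {(p, a, q). p \<in> states G \<and> a \<in> alphabet G \<and> q \<in> delta G p a}"

primrec delta_star :: "('q, 'a, 'm) nfa_scheme \<Rightarrow> 'q set \<Rightarrow> 'a list \<Rightarrow> 'q set" where
  "delta_star G X [] = X"
| "delta_star G X (a # w) = delta_star G (\<Union>q \<in> X. delta G q a) w"

definition language :: "('q, 'a, 'm) nfa_scheme \<Rightarrow> 'a list set" where
  "language G = {w \<in> lists (alphabet G). delta_star G (initial G) w \<noteq> {}}"

record ('q, 'a) des = "('q, 'a) nfa" +
  observable :: "'a set"
  unobservable :: "'a set"

text \<open>Either block of the partition of the alphabet may be empty.\<close>

definition is_des :: "('q, 'a, 'm) des_scheme \<Rightarrow> bool" where
  "is_des G \<longleftrightarrow>
     is_nfa G \<and>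
     observable G \<union> unobservable G = alphabet G \<and>
     observable G \<inter> unobservable G = {}"

definition projection :: "('q, 'a, 'm) des_scheme \<Rightarrow> 'a list \<Rightarrow> 'a list" where
  "projection G = filter (\<lambda>a. a \<in> observable G)"

definition k_step_opaque ::
  "enat \<Rightarrow> ('q, 'a, 'm) nfa_scheme \<Rightarrow> 'q set \<Rightarrow> 'q set \<Rightarrow> ('a list \<Rightarrow> 'a list) \<Rightarrow> bool" where
  "k_step_opaque K G QS QNS P \<longleftrightarrow>
     (\<forall>s t. s @ t \<in> language G \<and> enat (length (P t)) \<le> K \<and>
            delta_star G (delta_star G (initial G) s \<inter> QS) t \<noteq> {} \<longrightarrow>
        (\<exists>s' t'. s' @ t' \<in> language G \<and> P s = P s' \<and> P t = P t' \<and>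
            delta_star G (delta_star G (initial G) s' \<inter> QNS) t' \<noteq> {}))"

definition current_state_opaque ::
  "('q, 'a, 'm) nfa_scheme \<Rightarrow> 'q set \<Rightarrow> 'q set \<Rightarrow> ('a list \<Rightarrow> 'a list) \<Rightarrow> bool" where
  "current_state_opaque = k_step_opaque 0"

definition infinite_step_opaque ::
  "('q, 'a, 'm) nfa_scheme \<Rightarrow> 'q set \<Rightarrow> 'q set \<Rightarrow> ('a list \<Rightarrow> 'a list) \<Rightarrow> bool" where
  "infinite_step_opaque = k_step_opaque \<infinity>"

text \<open>The disjoint union of \<open>Q\<close>, \<open>Q\<^sup>+\<close> and \<open>Q\<^sup>-\<close>.\<close>

datatype 'q copies = Orig 'q | Plus 'q | Minus 'q

definition copy_transitions ::
  "('q \<Rightarrow> 'r) \<Rightarrow> ('q, 'a, 'm) nfa_scheme \<Rightarrow> ('r \<times> 'a \<times> 'r) set" where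
  "copy_transitions c G = {(c p, a, c q) | p a q. (p, a, q) \<in> transitions G}"

definition two_copies_transitions ::
  "('q, 'a, 'm) nfa_scheme \<Rightarrow> 'q set \<Rightarrow> 'q set \<Rightarrow> 'a \<Rightarrow> ('q copies \<times> 'a \<times> 'q copies) set" where
  "two_copies_transitions G QS QNS new =
     copy_transitions Orig G \<union> copy_transitions Plus G \<union> copy_transitions Minus G \<union>
     {(Orig q, new, Plus q) | q. q \<in> QS} \<union> {(Orig q, new, Minus q) | q. q \<in> QNS}"

text \<open>The system \<open>G''\<close>; \<open>new\<close> is the new observable event, intended not to lie in
  \<open>alphabet G\<close>.\<close>

definition two_copies ::
  "('q, 'a) des \<Rightarrow> 'q set \<Rightarrow> 'q set \<Rightarrow> 'a \<Rightarrow> ('q copies, 'a) des" where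
  "two_copies G QS QNS new =
     \<lparr>states = Orig ` states G \<union> Plus ` states G \<union> Minus ` states G,
      alphabet = insert new (alphabet G),
      delta = (\<lambda>x a. {y. (x, a, y) \<in> two_copies_transitions G QS QNS new}),
      initial = Orig ` initial G,
      observable = insert new (observable G),
      unobservable = unobservable G\<rparr>"

lemma is_des_two_copies:
  assumes "is_des G" "QS \<subseteq> states G" "QNS \<subseteq> states G" "new \<notin> alphabet G"
  shows "is_des (two_copies G QS QNS new)"
  using assms
  by (auto simp: subset_iff image_iff is_des_def is_nfa_def two_copies_def two_copies_transitions_def
      copy_transitions_def transitions_def)

end

theory Submission
  imports Defs
begin

text \<open>A run of \<open>G''\<close> ends in \<open>Q\<^sup>+\<close> (in \<open>Q\<^sup>-\<close>) exactly when its word is \<open>s @t\<close> with a single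
  occurrence of the new event \<open>@\<close>, where \<open>s\<close> leads \<open>G\<close> to a secret (non-secret) state from which
  \<open>t\<close> is possible.  Since \<open>@\<close> is observable, the observation of such a word determines the two
  observations \<open>P(s)\<close> and \<open>P(t)\<close>, so the current state of \<open>G''\<close> records whether \<open>G\<close> passed
  through a secret state any number of steps ago.\<close>

section \<open>Runs on sets of states\<close>

lemma delta_star_empty [simp]: "delta_star G {} w = {}"
  by (induction w) auto

lemma delta_star_Un: "delta_star G (X \<union> Y) w = delta_star G X w \<union> delta_star G Y w"
  by (induction w arbitrary: X Y) (simp_all add: UN_Un)

lemma delta_star_append: "delta_star G X (u @ v) = delta_star G (delta_star G X u) v"
  by (induction u arbitrary: X) simp_all

lemma delta_star_mono: "X \<subseteq> Y \<Longrightarrow> delta_star G X w \<subseteq> delta_star G Y w"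
  by (metis delta_star_Un sup.absorb_iff2)

text \<open>\<open>delta\<close> is constrained only on \<open>states G\<close> and
  \<open>alphabet G\<close>. This closure keeps later inductions inside that region, where the
  transitions of \<open>two_copies\<close> agree with \<open>delta\<close>.\<close>

lemma delta_image_subset_states:
  assumes "is_nfa G" "a \<in> alphabet G" "X \<subseteq> states G"
  shows "(\<Union>q \<in> X. delta G q a) \<subseteq> states G"
proof
  fix p assume "p \<in> (\<Union>q \<in> X. delta G q a)"
  then obtain q where "q \<in> X" "p \<in> delta G q a"
    by blast
  moreover have "\<forall>q \<in> states G. \<forall>a \<in> alphabet G. delta G q a \<subseteq> states G"
    using assms(1) by (simp add: is_nfa_def)
  then have "delta G q a \<subseteq> states G"
    using assms(2,3) \<open>q \<in> X\<close> by blast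
  ultimately show "p \<in> states G"
    by blast
qed

lemma delta_star_subset_states:
  assumes "is_nfa G" "w \<in> lists (alphabet G)" "X \<subseteq> states G"
  shows "delta_star G X w \<subseteq> states G"
  using assms(3,2)
proof (induction w arbitrary: X)
  case (Cons a w)
  have "(\<Union>q \<in> X. delta G q a) \<subseteq> states G"
    using delta_image_subset_states[OF assms(1) _ Cons.prems(1)] Cons.prems(2) by simp
  with Cons show ?case by simp
qed simp

section \<open>Projections and reformulations of opacity\<close>

lemma projection_append: "projection G (u @ v) = projection G u @ projection G v"
  by (simp add: projection_def)

text \<open>The bound on \<open>P t\<close> is vacuous for \<infinity>. A nonempty run via
  \<open>QS\<close> or \<open>QNS\<close> is already a run on the concatenated word, so membership
  in \<open>language G\<close> reduces to a condition on the letters.\<close>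

lemma infinite_step_opaque_iff:
  "infinite_step_opaque G QS QNS P \<longleftrightarrow>
     (\<forall>s \<in> lists (alphabet G). \<forall>t \<in> lists (alphabet G).
        delta_star G (delta_star G (initial G) s \<inter> QS) t \<noteq> {} \<longrightarrow>
        (\<exists>s' \<in> lists (alphabet G). \<exists>t' \<in> lists (alphabet G). P s = P s' \<and> P t = P t' \<and>
            delta_star G (delta_star G (initial G) s' \<inter> QNS) t' \<noteq> {}))"
proof -
  let ?run = "\<lambda>X s t. delta_star G (delta_star G (initial G) s \<inter> X) t \<noteq> {}"
  have "s @ t \<in> language G \<longleftrightarrow> s \<in> lists (alphabet G) \<and> t \<in> lists (alphabet G)"
    if "?run X s t" for X s t
  proof -
    have "delta_star G (delta_star G (initial G) s \<inter> X) t \<subseteq> delta_star G (initial G) (s @ t)"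
      unfolding delta_star_append by (intro delta_star_mono) simp
    with that show ?thesis
      by (auto simp: language_def)
  qed
  then have run_iff: "s @ t \<in> language G \<and> ?run X s t \<longleftrightarrow>
      s \<in> lists (alphabet G) \<and> t \<in> lists (alphabet G) \<and> ?run X s t" for X s t
    by (metis (no_types, lifting))
  \<comment> \<open>Pure logic for abstract predicates: the memberships \<open>A\<close> move into
    the bounded quantifiers. \<open>E\<close> stands for equality of observations.\<close>
  have bounded_iff:
    "(\<forall>s t. A s \<and> A t \<and> R s t \<longrightarrow> (\<exists>s' t'. (A s' \<and> A t' \<and> N s' t') \<and> E s s' \<and> E t t')) \<longleftrightarrow>
     (\<forall>s. A s \<longrightarrow> (\<forall>t. A t \<longrightarrow> R s t \<longrightarrow>
        (\<exists>s'. A s' \<and> (\<exists>t'. A t' \<and> E s s' \<and> E t t' \<and> N s' t'))))"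
    for A :: "'b list \<Rightarrow> bool" and R N E
    by blast
  have "infinite_step_opaque G QS QNS P \<longleftrightarrow>
     (\<forall>s t. s @ t \<in> language G \<and> ?run QS s t \<longrightarrow>
        (\<exists>s' t'. (s' @ t' \<in> language G \<and> ?run QNS s' t') \<and> P s = P s' \<and> P t = P t'))"
    unfolding infinite_step_opaque_def k_step_opaque_def
    by (simp only: enat_ord_simps simp_thms conj_assoc conj_left_commute conj_commute)
  then show ?thesis
    unfolding run_iff Ball_def Bex_def
    by (simp only: bounded_iff[where E = "\<lambda>u v. P u = P v"])
qed

text \<open>In \<open>0\<close>-step opacity the unobservable continuations play no role, as the continuation
  required for the non-secret run may be chosen empty.\<close>

lemma current_state_opaque_iff:
  "current_state_opaque G QS QNS (projection G) \<longleftrightarrow>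
     (\<forall>s \<in> lists (alphabet G). delta_star G (initial G) s \<inter> QS \<noteq> {} \<longrightarrow>
        (\<exists>s' \<in> lists (alphabet G). projection G s = projection G s' \<and>
            delta_star G (initial G) s' \<inter> QNS \<noteq> {}))"
  (is "_ \<longleftrightarrow> ?rhs")
proof
  assume opaque: "current_state_opaque G QS QNS (projection G)"
  show ?rhs
  proof (intro ballI impI)
    fix s assume "s \<in> lists (alphabet G)" "delta_star G (initial G) s \<inter> QS \<noteq> {}"
    then have "s @ [] \<in> language G" "delta_star G (delta_star G (initial G) s \<inter> QS) [] \<noteq> {}"
      by (auto simp: language_def)
    \<comment> \<open>The empty continuation is within the bound 0, so the secret run may stop right
      after \<open>s\<close>.\<close>
    moreover have "enat (length (projection G [])) \<le> 0"
      by (simp add: projection_def zero_enat_def)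
    ultimately obtain s' t' where "s' @ t' \<in> language G" "projection G s = projection G s'"
        "delta_star G (delta_star G (initial G) s' \<inter> QNS) t' \<noteq> {}"
      using opaque unfolding current_state_opaque_def k_step_opaque_def by blast
    then show "\<exists>s' \<in> lists (alphabet G). projection G s = projection G s' \<and>
        delta_star G (initial G) s' \<inter> QNS \<noteq> {}"
      by (intro bexI[of _ s']) (auto simp: language_def)
  qed
next
  assume rhs: ?rhs
  show "current_state_opaque G QS QNS (projection G)"
    unfolding current_state_opaque_def k_step_opaque_def
  proof (intro allI impI, elim conjE)
    fix s t
    assume st: "s @ t \<in> language G" "enat (length (projection G t)) \<le> 0"
      and "delta_star G (delta_star G (initial G) s \<inter> QS) t \<noteq> {}"
    then have "delta_star G (initial G) s \<inter> QS \<noteq> {}" "s \<in> lists (alphabet G)"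
      by (auto simp: language_def)
    with rhs obtain s' where s': "s' \<in> lists (alphabet G)" "projection G s = projection G s'"
        "delta_star G (initial G) s' \<inter> QNS \<noteq> {}"
      by blast
    \<comment> \<open>A continuation within the bound 0 has an empty observation, which
      \<open>[]\<close> reproduces.\<close>
    have "projection G t = projection G []"
      using st(2) by (simp add: projection_def zero_enat_def)
    with s' show "\<exists>s' t'. s' @ t' \<in> language G \<and> projection G s = projection G s' \<and>
        projection G t = projection G t' \<and>
        delta_star G (delta_star G (initial G) s' \<inter> QNS) t' \<noteq> {}"
      by (intro exI[of _ s'] exI[of _ "[]"]) (auto simp: language_def)
  qed
qed

section \<open>Runs of the extended system\<close>

lemmas two_copies_delta_simps =
  two_copies_def two_copies_transitions_def copy_transitions_def transitions_def

text \<open>The only transitions leaving a \<open>Plus\<close> or \<open>Minus\<close> state are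
  those of its own copy of \<open>G\<close>, so a run stays in that copy and dies at the first
  letter outside \<open>alphabet G\<close>.\<close>

lemma delta_star_two_copies_copy:
  assumes "is_nfa G" "X \<subseteq> states G" "c = Plus \<or> c = Minus"
  shows "delta_star (two_copies G QS QNS new) (c ` X) w =
    (if w \<in> lists (alphabet G) then c ` delta_star G X w else {})"
  using assms(2)
proof (induction w arbitrary: X)
  case (Cons a w)
  show ?case
  proof (cases "a \<in> alphabet G")
    case True
    then have "(\<Union>q \<in> c ` X. delta (two_copies G QS QNS new) q a) = c ` (\<Union>q \<in> X. delta G q a)"
      using assms(1,3) Cons.prems
      by (auto simp: two_copies_delta_simps is_nfa_def subset_iff)
    moreover have "(\<Union>q \<in> X. delta G q a) \<subseteq> states G"
      using delta_image_subset_states[OF assms(1) True Cons.prems] .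
    ultimately show ?thesis
      using True Cons.IH by simp
  next
    case False
    then have "(\<Union>q \<in> c ` X. delta (two_copies G QS QNS new) q a) = {}"
      using assms(3) by (auto simp: two_copies_delta_simps)
    with False show ?thesis by simp
  qed
qed simp

text \<open>The only way out of \<open>Orig\<close> is the event \<open>new\<close>, which cannot
  occur in a word over \<open>alphabet G\<close>.\<close>

lemma delta_star_two_copies_Orig:
  assumes "is_nfa G" "X \<subseteq> states G" "new \<notin> alphabet G" "w \<in> lists (alphabet G)"
  shows "delta_star (two_copies G QS QNS new) (Orig ` X) w = Orig ` delta_star G X w"
  using assms(2,4)
proof (induction w arbitrary: X)
  case (Cons a w)
  have "(\<Union>q \<in> Orig ` X. delta (two_copies G QS QNS new) q a) = Orig ` (\<Union>q \<in> X. delta G q a)"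
    using assms(1,3) Cons.prems
    by (auto simp: two_copies_delta_simps is_nfa_def subset_iff)
  moreover have "(\<Union>q \<in> X. delta G q a) \<subseteq> states G"
    using delta_image_subset_states[OF assms(1) _ Cons.prems(1)] Cons.prems(2) by simp
  ultimately show ?case
    using Cons by simp
qed simp

text \<open>At \<open>new\<close> the run branches into the two copies, which then evolve
  independently. A further \<open>new\<close> in \<open>t\<close> kills both branches, hence the
  case distinction.\<close>

lemma delta_star_two_copies_new:
  assumes "is_nfa G" "X \<subseteq> states G" "QS \<subseteq> states G" "QNS \<subseteq> states G" "new \<notin> alphabet G"
    and "s \<in> lists (alphabet G)"
  shows "delta_star (two_copies G QS QNS new) (Orig ` X) (s @ new # t) =
    (if t \<in> lists (alphabet G)
     then Plus ` delta_star G (delta_star G X s \<inter> QS) t \<union>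
          Minus ` delta_star G (delta_star G X s \<inter> QNS) t
     else {})"
proof -
  let ?Y = "delta_star G X s"
  \<comment> \<open>As \<open>new\<close> is not in \<open>alphabet G\<close>, no copy of
    \<open>G\<close> has a transition on it; only those crossing from \<open>Orig\<close> to the
    other copies remain.\<close>
  have "(\<Union>q \<in> Orig ` ?Y. delta (two_copies G QS QNS new) q new) =
      Plus ` (?Y \<inter> QS) \<union> Minus ` (?Y \<inter> QNS)"
    using assms(5) by (auto simp: two_copies_delta_simps)
  moreover have "?Y \<inter> QS \<subseteq> states G" "?Y \<inter> QNS \<subseteq> states G"
    using assms(3,4) by auto
  ultimately show ?thesis
    using assms by (simp add: delta_star_append delta_star_two_copies_Orig delta_star_Un
        delta_star_two_copies_copy)
qed

text \<open>Splitting at the first occurrence of \<open>a\<close> puts the prefix into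
  \<open>lists A\<close>, while the suffix may contain \<open>a\<close> again.\<close>

lemma lists_insert_cases:
  assumes "w \<in> lists (insert a A)"
  obtains "w \<in> lists A" | u v where "w = u @ a # v" "u \<in> lists A" "v \<in> lists (insert a A)"
proof (cases "a \<in> set w")
  case True
  then obtain u v where "w = u @ a # v" "a \<notin> set u"
    by (meson split_list_first)
  with assms show thesis by (intro that(2)) (auto simp: in_lists_conv_set)
next
  case False
  with assms show thesis by (intro that(1)) (auto simp: in_lists_conv_set)
qed

text \<open>Only \<open>new\<close> leads out of \<open>Orig\<close>, and nothing leads out of
  \<open>Plus\<close> or \<open>Minus\<close>. Hence the kind of state reached reveals whether the
  word has no \<open>new\<close> or exactly one, and runs transfer between the two systems.\<close>

lemma delta_star_two_copies_reach:
  assumes "is_nfa G" "QS \<subseteq> states G" "QNS \<subseteq> states G" "new \<notin> alphabet G"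
    and w: "w \<in> lists (insert new (alphabet G))"
  defines "R \<equiv> delta_star (two_copies G QS QNS new) (Orig ` initial G) w"
  shows "R \<inter> Plus ` states G \<noteq> {} \<longleftrightarrow>
      (\<exists>s \<in> lists (alphabet G). \<exists>t \<in> lists (alphabet G). w = s @ new # t \<and>
         delta_star G (delta_star G (initial G) s \<inter> QS) t \<noteq> {})" (is "?P \<longleftrightarrow> ?P'")
    and "R \<inter> Minus ` states G \<noteq> {} \<longleftrightarrow>
      (\<exists>s \<in> lists (alphabet G). \<exists>t \<in> lists (alphabet G). w = s @ new # t \<and>
         delta_star G (delta_star G (initial G) s \<inter> QNS) t \<noteq> {})" (is "?M \<longleftrightarrow> ?M'")
    and "R \<inter> Orig ` states G \<noteq> {} \<Longrightarrow> w \<in> lists (alphabet G)"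
proof -
  have init: "initial G \<subseteq> states G"
    using assms(1) by (simp add: is_nfa_def)
  have new: "R = (if t \<in> lists (alphabet G)
     then Plus ` delta_star G (delta_star G (initial G) s \<inter> QS) t \<union>
          Minus ` delta_star G (delta_star G (initial G) s \<inter> QNS) t
     else {})" if "w = s @ new # t" "s \<in> lists (alphabet G)" for s t
    unfolding R_def that(1)
    using delta_star_two_copies_new[OF assms(1) init assms(2-4) that(2)] .
  have sub: "delta_star G (delta_star G (initial G) s \<inter> Y) t \<subseteq> states G"
    if "t \<in> lists (alphabet G)" "Y \<subseteq> states G" for s t Y
    using that by (intro delta_star_subset_states assms(1)) auto
  have old: "R \<subseteq> range Orig" if "w \<in> lists (alphabet G)"
    unfolding R_def using delta_star_two_copies_Orig[OF assms(1) init assms(4) that] by auto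
  \<comment> \<open>The prefix before the first \<open>new\<close> lies over
    \<open>alphabet G\<close>; a second \<open>new\<close> after it would make \<open>R\<close>
    empty by the description of \<open>R\<close> above.\<close>
  have split: "\<exists>s \<in> lists (alphabet G). \<exists>t \<in> lists (alphabet G). w = s @ new # t"
    if "R \<noteq> {}" "w \<notin> lists (alphabet G)"
    using w
  proof (cases rule: lists_insert_cases)
    case 1
    with that(2) show ?thesis by simp
  next
    case (2 s t)
    then show ?thesis using new that(1) by (metis (full_types))
  qed
  show "?P \<longleftrightarrow> ?P'"
  proof
    assume P: ?P
    with old have "w \<notin> lists (alphabet G)" by auto
    with split P obtain s t where st: "w = s @ new # t" "s \<in> lists (alphabet G)" "t \<in> lists (alphabet G)"
      by blast
    then have "delta_star G (delta_star G (initial G) s \<inter> QS) t \<noteq> {}"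
      using new[OF st(1,2)] P by auto
    with st show ?P' by blast
  next
    assume ?P'
    then obtain s t q where st: "w = s @ new # t" "s \<in> lists (alphabet G)" "t \<in> lists (alphabet G)"
        and q: "q \<in> delta_star G (delta_star G (initial G) s \<inter> QS) t"
      by blast
    then have "Plus q \<in> R" "q \<in> states G"
      using new[OF st(1,2)] sub[OF st(3) assms(2)] by auto
    then show ?P by blast
  qed
  show "?M \<longleftrightarrow> ?M'"
  proof
    assume M: ?M
    with old have "w \<notin> lists (alphabet G)" by auto
    with split M obtain s t where st: "w = s @ new # t" "s \<in> lists (alphabet G)" "t \<in> lists (alphabet G)"
      by blast
    then have "delta_star G (delta_star G (initial G) s \<inter> QNS) t \<noteq> {}"
      using new[OF st(1,2)] M by auto
    with st show ?M' by blast
  next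
    assume ?M'
    then obtain s t q where st: "w = s @ new # t" "s \<in> lists (alphabet G)" "t \<in> lists (alphabet G)"
        and q: "q \<in> delta_star G (delta_star G (initial G) s \<inter> QNS) t"
      by blast
    then have "Minus q \<in> R" "q \<in> states G"
      using new[OF st(1,2)] sub[OF st(3) assms(3)] by auto
    then show ?M by blast
  qed
  show "w \<in> lists (alphabet G)" if O: "R \<inter> Orig ` states G \<noteq> {}"
  proof (rule ccontr)
    assume "w \<notin> lists (alphabet G)"
    with split O obtain s t where "w = s @ new # t" "s \<in> lists (alphabet G)" "t \<in> lists (alphabet G)"
      by blast
    \<comment> \<open>After \<open>new\<close>, \<open>R\<close> consists of \<open>Plus\<close> and
      \<open>Minus\<close> states only.\<close>
    with new[of s t] O show False by (simp add: Int_Un_distrib2 image_iff) blast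
  qed
qed

section \<open>Observations in the extended system and the equivalence\<close>

lemma projection_two_copies:
  "w \<in> lists (alphabet G) \<Longrightarrow> new \<notin> alphabet G \<Longrightarrow>
    projection (two_copies G QS QNS new) w = projection G w"
  by (auto simp: projection_def two_copies_def in_lists_conv_set intro!: filter_cong)

text \<open>Being observable, \<open>new\<close> survives the projection as a marker between the two
  observations.\<close>

lemma projection_two_copies_split:
  assumes "s \<in> lists (alphabet G)" "t \<in> lists (alphabet G)" "new \<notin> alphabet G"
  shows "projection (two_copies G QS QNS new) (s @ new # t) = projection G s @ new # projection G t"
proof -
  have "projection (two_copies G QS QNS new) (new # t) =
      new # projection (two_copies G QS QNS new) t"
    by (simp add: projection_def two_copies_def)
  then show ?thesis
    using assms by (simp add: projection_append projection_two_copies)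
qed

theorem theorem8:
  fixes G :: "('q, 'a) des"
    and QS QNS :: "'q set"
    and new :: 'a
  assumes "is_des G"
    and "QS \<subseteq> states G"
    and "QNS \<subseteq> states G"
    and "new \<notin> alphabet G"
  shows "infinite_step_opaque G QS QNS (projection G) \<longleftrightarrow>
    current_state_opaque (two_copies G QS QNS new)
      (Plus ` states G)
      (Orig ` states G \<union> Minus ` states G)
      (projection (two_copies G QS QNS new))"
proof -
  let ?H = "two_copies G QS QNS new"
  let ?A = "lists (alphabet G)"
  let ?B = "lists (insert new (alphabet G))"
  let ?S = "\<lambda>s t. delta_star G (delta_star G (initial G) s \<inter> QS) t \<noteq> {}"
  let ?N = "\<lambda>s t. delta_star G (delta_star G (initial G) s \<inter> QNS) t \<noteq> {}"
  let ?R = "delta_star ?H (Orig ` initial G)"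
  have nfa: "is_nfa G"
    using assms(1) by (simp add: is_des_def)
  note reach = delta_star_two_copies_reach[OF nfa assms(2-4)]
  have H: "alphabet ?H = insert new (alphabet G)" "initial ?H = Orig ` initial G"
    by (simp_all add: two_copies_def)
  have B: "s @ new # t \<in> ?B" if "s \<in> ?A" "t \<in> ?A" for s t
    using that by (auto simp: in_lists_conv_set)
  have new_proj: "new \<notin> set (projection G s)" if "s \<in> ?A" for s
    using that assms(4) by (auto simp: projection_def in_lists_conv_set)
  \<comment> \<open>By \<open>new_proj\<close>, the marker \<open>new\<close> occurs exactly once in
    each observation, so the parts before and after it can be compared separately.\<close>
  have proj_eq: "projection ?H (s @ new # t) = projection ?H (s' @ new # t') \<longleftrightarrow>
      projection G s = projection G s' \<and> projection G t = projection G t'"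
    if "s \<in> ?A" "t \<in> ?A" "s' \<in> ?A" "t' \<in> ?A" for s t s' t'
    using that assms(4) by (simp add: projection_two_copies_split append_Cons_eq_iff new_proj)
  show ?thesis
    unfolding infinite_step_opaque_iff current_state_opaque_iff H
  proof (intro iffI ballI impI)
    fix w
    assume opaque: "\<forall>s\<in>?A. \<forall>t\<in>?A. ?S s t \<longrightarrow> (\<exists>s'\<in>?A. \<exists>t'\<in>?A.
        projection G s = projection G s' \<and> projection G t = projection G t' \<and> ?N s' t')"
      and "w \<in> ?B" "?R w \<inter> Plus ` states G \<noteq> {}"
    then obtain s t where st: "s \<in> ?A" "t \<in> ?A" "w = s @ new # t" "?S s t"
      using reach(1)[of w] by blast
    with opaque obtain s' t' where st': "s' \<in> ?A" "t' \<in> ?A" "?N s' t'"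
        "projection G s = projection G s'" "projection G t = projection G t'"
      by blast
    \<comment> \<open>The non-secret run of \<open>G\<close> is replayed with \<open>new\<close>
      inserted between \<open>s'\<close> and \<open>t'\<close>, so it ends in the
      \<open>Minus\<close> copy.\<close>
    then have "?R (s' @ new # t') \<inter> Minus ` states G \<noteq> {}"
      unfolding reach(2)[OF B[OF st'(1,2)]] by blast
    moreover have "projection ?H w = projection ?H (s' @ new # t')"
      using st(1-3) st' by (simp add: proj_eq)
    ultimately show "\<exists>w'\<in>?B. projection ?H w = projection ?H w' \<and>
        ?R w' \<inter> (Orig ` states G \<union> Minus ` states G) \<noteq> {}"
      using B[OF st'(1,2)] by blast
  next
    fix s t
    assume opaque: "\<forall>w\<in>?B. ?R w \<inter> Plus ` states G \<noteq> {} \<longrightarrow> (\<exists>w'\<in>?B.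
        projection ?H w = projection ?H w' \<and>
        ?R w' \<inter> (Orig ` states G \<union> Minus ` states G) \<noteq> {})"
      and st: "s \<in> ?A" "t \<in> ?A" "?S s t"
    \<comment> \<open>Inserting \<open>new\<close> where the secret state is visited makes the run
      end in a secret state of \<open>?H\<close>.\<close>
    have "?R (s @ new # t) \<inter> Plus ` states G \<noteq> {}"
      unfolding reach(1)[OF B[OF st(1,2)]] using st by blast
    from opaque[rule_format, OF B[OF st(1,2)] this] obtain w' where w': "w' \<in> ?B"
        "projection ?H (s @ new # t) = projection ?H w'"
        "?R w' \<inter> (Orig ` states G \<union> Minus ` states G) \<noteq> {}"
      by blast
    \<comment> \<open>\<open>Orig\<close> states are non-secret in \<open>?H\<close>, but words
      reaching them show no \<open>new\<close>, so they cannot match the observation of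
      \<open>s @ new # t\<close>. The matching run must therefore end in
      \<open>Minus\<close>.\<close>
    have "w' \<notin> ?A"
    proof
      assume "w' \<in> ?A"
      then have "new \<notin> set (projection ?H w')"
        using assms(4) new_proj by (simp add: projection_two_copies)
      then show False
        using w'(2) st assms(4) by (metis projection_two_copies_split in_set_conv_decomp)
    qed
    with w' reach(3)[OF w'(1)] have "?R w' \<inter> Minus ` states G \<noteq> {}"
      by blast
    with reach(2)[OF w'(1)]
    obtain s' t' where st': "s' \<in> ?A" "t' \<in> ?A" "w' = s' @ new # t'" "?N s' t'"
      by blast
    with w'(2) proj_eq[OF st(1,2) st'(1,2)] show "\<exists>s'\<in>?A. \<exists>t'\<in>?A.
        projection G s = projection G s' \<and> projection G t = projection G t' \<and> ?N s' t'"
      by blast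
  qed
qed

end
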